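(* Let $\mathbf{A}$ be a normal and quasicomplemented distributive nearlattice and let $F\subseteq A$. Then $F$ is an $\alpha$-filter if and only if $F$ is an $\alpha$-ideal-congruence-kernel, i.e. there exists an $\alpha$-ideal $I$ of $A$ with $F=\ker\theta(I)$.
   Context: A distributive nearlattice is a join-semilattice $\langle A,\vee,1\rangle$ with greatest element $1$ in which every principal filter $[a)=\{x\in A\colon a\le x\}$ is a bounded distributive lattice. A filter of $A$ is a subset containing $1$, upward closed, and closed under those binary meets that exist. An ideal is a non-empty subset that is downward closed and closed under $\vee$. For $a\in A$, $a^{\top}=\{x\in A\colon x\vee a=1\}$ and $a^{\top\top}=\{y\in A\colon y\vee x=1\text{ for all }x\in a^{\top}\}$. A filter $F$ is an $\alpha$-filter if $a^{\top\top}\subseteq F$ for all $a\in F$. An ideal $I$ is an $\alpha$-ideal if for each $a\in A$, $I\cap a^{\top\top}\neq\emptyset$ implies $a\in I$. For an ideal $I$, $\theta(I)=\{(a,b)\in A\times A\colon \exists i\in I\ (a\vee i=b\vee i)\}$ (a congruence of $\mathbf{A}$), and for a congruence $\theta$, $\ker\theta=\{a\in A\colon (a,1)\in\theta\}$. A prime ideal is a proper ideal $P$ with $a\wedge b\in P\Rightarrow a\in P$ or $b\in P$ whenever $a\wedge b$ exists; a maximal ideal is a proper ideal not properly contained in any proper ideal. $\mathbf{A}$ is normal if each prime ideal is contained in a unique maximal ideal; $\mathbf{A}$ is quasicomplemented if for each $a\in A$ there exists $b\in A$ with $a^{\top\top}=b^{\top}$. *)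

theory Defs
  imports Main
begin

text \<open>Binary infima and suprema relative to the order induced on a subset \<open>S\<close>, as relations
  because they need not exist.\<close>

definition (in order) is_inf_on :: "'a set \<Rightarrow> 'a \<Rightarrow> 'a \<Rightarrow> 'a \<Rightarrow> bool" where
  "is_inf_on S x y m \<longleftrightarrow>
     m \<in> S \<and> m \<le> x \<and> m \<le> y \<and> (\<forall>z\<in>S. z \<le> x \<and> z \<le> y \<longrightarrow> z \<le> m)"

definition (in order) is_sup_on :: "'a set \<Rightarrow> 'a \<Rightarrow> 'a \<Rightarrow> 'a \<Rightarrow> bool" where
  "is_sup_on S x y s \<longleftrightarrow>
     s \<in> S \<and> x \<le> s \<and> y \<le> s \<and> (\<forall>z\<in>S. x \<le> z \<and> y \<le> z \<longrightarrow> s \<le> z)"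

definition (in order) lattice_on :: "'a set \<Rightarrow> bool" where
  "lattice_on S \<longleftrightarrow>
     (\<forall>x\<in>S. \<forall>y\<in>S. (\<exists>m. is_inf_on S x y m) \<and> (\<exists>s. is_sup_on S x y s))"

text \<open>The law \<open>x \<and> (y \<or> z) = (x \<and> y) \<or> (x \<and> z)\<close>, in relational form.\<close>

definition (in order) distributive_on :: "'a set \<Rightarrow> bool" where
  "distributive_on S \<longleftrightarrow>
     (\<forall>x\<in>S. \<forall>y\<in>S. \<forall>z\<in>S. \<forall>s m m1 m2.
        is_sup_on S y z s \<longrightarrow> is_inf_on S x s m \<longrightarrow>
        is_inf_on S x y m1 \<longrightarrow> is_inf_on S x z m2 \<longrightarrow> is_sup_on S m1 m2 m)"

definition (in order) bounded_on :: "'a set \<Rightarrow> bool" where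
  "bounded_on S \<longleftrightarrow> (\<exists>l\<in>S. \<forall>x\<in>S. l \<le> x) \<and> (\<exists>g\<in>S. \<forall>x\<in>S. x \<le> g)"

definition (in order) bounded_distributive_lattice_on :: "'a set \<Rightarrow> bool" where
  "bounded_distributive_lattice_on S \<longleftrightarrow> lattice_on S \<and> distributive_on S \<and> bounded_on S"

text \<open>The nearlattice is the whole type; its greatest element \<open>1\<close> is \<^const>\<open>top\<close>, and the
  principal filter \<open>[a)\<close> is \<open>{a..}\<close>.\<close>

class distributive_nearlattice = semilattice_sup + order_top +
  assumes principal_filter: "bounded_distributive_lattice_on {a..}"

definition nl_filter :: "'a::distributive_nearlattice set \<Rightarrow> bool" where
  "nl_filter F \<longleftrightarrow>
     top \<in> F \<and>
     (\<forall>x y. x \<in> F \<longrightarrow> x \<le> y \<longrightarrow> y \<in> F) \<and>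
     (\<forall>x y m. x \<in> F \<longrightarrow> y \<in> F \<longrightarrow> is_inf_on UNIV x y m \<longrightarrow> m \<in> F)"

definition nl_ideal :: "'a::distributive_nearlattice set \<Rightarrow> bool" where
  "nl_ideal I \<longleftrightarrow>
     I \<noteq> {} \<and>
     (\<forall>x y. y \<in> I \<longrightarrow> x \<le> y \<longrightarrow> x \<in> I) \<and>
     (\<forall>x y. x \<in> I \<longrightarrow> y \<in> I \<longrightarrow> sup x y \<in> I)"

definition annihilator :: "'a::distributive_nearlattice \<Rightarrow> 'a set" where
  "annihilator a = {x. sup x a = top}"

definition biannihilator :: "'a::distributive_nearlattice \<Rightarrow> 'a set" where
  "biannihilator a = {y. \<forall>x\<in>annihilator a. sup y x = top}"

definition alpha_filter :: "'a::distributive_nearlattice set \<Rightarrow> bool" where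
  "alpha_filter F \<longleftrightarrow> nl_filter F \<and> (\<forall>a\<in>F. biannihilator a \<subseteq> F)"

definition alpha_ideal :: "'a::distributive_nearlattice set \<Rightarrow> bool" where
  "alpha_ideal I \<longleftrightarrow> nl_ideal I \<and> (\<forall>a. I \<inter> biannihilator a \<noteq> {} \<longrightarrow> a \<in> I)"

definition ideal_congruence :: "'a::distributive_nearlattice set \<Rightarrow> ('a \<times> 'a) set" where
  "ideal_congruence I = {(a, b). \<exists>i\<in>I. sup a i = sup b i}"

definition congruence_kernel :: "('a::distributive_nearlattice \<times> 'a) set \<Rightarrow> 'a set" where
  "congruence_kernel \<theta> = {a. (a, top) \<in> \<theta>}"

definition alpha_ideal_congruence_kernel :: "'a::distributive_nearlattice set \<Rightarrow> bool" where
  "alpha_ideal_congruence_kernel F \<longleftrightarrow>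
     (\<exists>I. alpha_ideal I \<and> F = congruence_kernel (ideal_congruence I))"

definition prime_ideal :: "'a::distributive_nearlattice set \<Rightarrow> bool" where
  "prime_ideal P \<longleftrightarrow>
     nl_ideal P \<and> P \<noteq> UNIV \<and>
     (\<forall>a b m. is_inf_on UNIV a b m \<longrightarrow> m \<in> P \<longrightarrow> a \<in> P \<or> b \<in> P)"

definition maximal_ideal :: "'a::distributive_nearlattice set \<Rightarrow> bool" where
  "maximal_ideal M \<longleftrightarrow>
     nl_ideal M \<and> M \<noteq> UNIV \<and> (\<nexists>J. nl_ideal J \<and> J \<noteq> UNIV \<and> M \<subset> J)"

definition normal_nearlattice :: "'a::distributive_nearlattice itself \<Rightarrow> bool" where
  "normal_nearlattice _ \<longleftrightarrow>
     (\<forall>P::'a set. prime_ideal P \<longrightarrow> (\<exists>!M. maximal_ideal M \<and> P \<subseteq> M))"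

definition quasicomplemented_nearlattice :: "'a::distributive_nearlattice itself \<Rightarrow> bool" where
  "quasicomplemented_nearlattice _ \<longleftrightarrow>
     (\<forall>a::'a. \<exists>b. biannihilator a = annihilator b)"

end

theory Submission
  imports Defs
begin

text \<open>A set is of the form \<open>ker \<theta>(I)\<close> with \<open>I\<close> an \<open>\<alpha>\<close>-ideal only if it is an \<open>\<alpha>\<close>-filter, because
  \<open>ker \<theta>(I)\<close> is the union of the sets \<open>i\<^sup>\<top>\<close> for \<open>i \<in> I\<close>. Conversely, given an \<open>\<alpha>\<close>-filter \<open>F\<close>, take
  \<open>I = {x. x\<^sup>\<top> \<subseteq> F}\<close>. Quasicomplements show that \<open>I\<close> is non-empty and that \<open>F \<subseteq> ker \<theta>(I)\<close>.
  Normality shows that \<open>I\<close> is closed under joins: if \<open>x\<^sup>\<top> \<subseteq> F\<close>, \<open>y\<^sup>\<top> \<subseteq> F\<close> and \<open>z \<or> x \<or> y = 1\<close>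
  but \<open>z \<notin> F\<close>, some prime ideal \<open>P\<close> contains \<open>z\<close> and misses \<open>F\<close>. As \<open>P\<close> misses \<open>x\<^sup>\<top>\<close> and \<open>y\<^sup>\<top>\<close>,
  the ideals generated by \<open>P\<close> and \<open>x\<close>, and by \<open>P\<close> and \<open>y\<close>, are proper; so the only maximal
  ideal above \<open>P\<close> contains \<open>x\<close>, \<open>y\<close> and \<open>z\<close>, hence \<open>1\<close>.\<close>

section \<open>Distributivity with partial meets\<close>

lemma sup_top_nearlattice [simp]:
  "sup x top = (top :: 'a::distributive_nearlattice)"
  "sup top x = (top :: 'a::distributive_nearlattice)"
  by (rule top_le, simp)+

text \<open>Distributivity in \<open>{m..}\<close> writes \<open>w\<close> as the join of its meets
  with \<open>r\<close> and with \<open>a\<close>. The last hypothesis puts the second meet below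
  \<open>r\<close>, so \<open>a\<close> can be cancelled from
  \<open>w \<le> sup r a\<close>.\<close>

lemma le_if_le_sup_if_common_lower_bounds_le:
  fixes m w r a :: "'a::distributive_nearlattice"
  assumes "m \<le> w" "m \<le> r" "m \<le> a" and w: "w \<le> sup r a"
    and lower: "\<And>v. m \<le> v \<Longrightarrow> v \<le> w \<Longrightarrow> v \<le> a \<Longrightarrow> v \<le> r"
  shows "w \<le> r"
proof -
  have L: "lattice_on {m..}" and D: "distributive_on {m..}"
    using principal_filter[of m] by (auto simp: bounded_distributive_lattice_on_def)
  obtain u where u: "is_inf_on {m..} w r u"
    using L assms(1,2) unfolding lattice_on_def by auto
  obtain v where v: "is_inf_on {m..} w a v"
    using L assms(1,3) unfolding lattice_on_def by auto
  have "is_sup_on {m..} r a (sup r a)"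
    using assms by (auto simp: is_sup_on_def intro: le_supI1)
  moreover have "is_inf_on {m..} w (sup r a) w"
    using assms by (auto simp: is_inf_on_def)
  ultimately have "is_sup_on {m..} u v w"
    using D u v assms(1-3) unfolding distributive_on_def by (meson atLeast_iff)
  moreover have "u \<le> r" "v \<le> r" using u v lower by (auto simp: is_inf_on_def)
  ultimately show ?thesis using assms(2) by (auto simp: is_sup_on_def)
qed

lemma is_inf_on_sup_left:
  fixes a b m r :: "'a::distributive_nearlattice"
  assumes inf: "is_inf_on UNIV a b m" and r: "m \<le> r"
  shows "is_inf_on UNIV (sup r a) (sup r b) r"
proof -
  have m: "m \<le> a" "m \<le> b" and glb: "\<And>z. z \<le> a \<Longrightarrow> z \<le> b \<Longrightarrow> z \<le> m"
    using inf by (auto simp: is_inf_on_def)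
  have "z \<le> r" if z: "z \<le> sup r a" "z \<le> sup r b" for z
  proof -
    \<comment> \<open>Since \<open>z\<close> need not lie above \<open>m\<close>,
      \<open>sup z m\<close> replaces it, so that everything happens in \<open>{m..}\<close>. The
      outer cancellation removes \<open>a\<close>, the inner one \<open>b\<close>; what remains is a
      common lower bound of \<open>a\<close> and \<open>b\<close>, hence below
      \<open>m \<le> r\<close>.\<close>
    have "sup z m \<le> r"
    proof (rule le_if_le_sup_if_common_lower_bounds_le[of m _ r a])
      show "sup z m \<le> sup r a" using z r by (simp add: le_supI1)
      fix v assume v: "m \<le> v" "v \<le> sup z m" "v \<le> a"
      show "v \<le> r"
      proof (rule le_if_le_sup_if_common_lower_bounds_le[of m _ r b])
        have "sup z m \<le> sup r b" using z r by (simp add: le_supI1)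
        then show "v \<le> sup r b" using v by (blast intro: order_trans)
      qed (use v r m glb in \<open>auto intro: order_trans\<close>)
    qed (use r m in auto)
    then show ?thesis by simp
  qed
  then show ?thesis by (auto simp: is_inf_on_def)
qed

section \<open>Ideals generated by an ideal and an element; maximal and prime ideals\<close>

definition ideal_adjoin :: "'a::distributive_nearlattice set \<Rightarrow> 'a \<Rightarrow> 'a set" where
  "ideal_adjoin P a = {x. \<exists>p\<in>P. x \<le> sup p a}"

lemma nl_ideal_adjoin:
  assumes "nl_ideal P"
  shows "nl_ideal (ideal_adjoin P a)"
  unfolding nl_ideal_def
proof (intro conjI allI impI)
  show "ideal_adjoin P a \<noteq> {}"
    using assms by (auto simp: nl_ideal_def ideal_adjoin_def)
next
  fix x y assume "y \<in> ideal_adjoin P a" "x \<le> y"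
  then show "x \<in> ideal_adjoin P a" by (auto simp: ideal_adjoin_def intro: order_trans)
next
  fix x y assume "x \<in> ideal_adjoin P a" "y \<in> ideal_adjoin P a"
  then obtain p q where pq: "p \<in> P" "q \<in> P" "x \<le> sup p a" "y \<le> sup q a"
    by (auto simp: ideal_adjoin_def)
  have "sup x y \<le> sup (sup p a) (sup q a)" using pq by (intro sup_mono)
  also have "\<dots> = sup (sup p q) a" by (simp add: ac_simps)
  finally have "sup x y \<le> sup (sup p q) a" .
  moreover have "sup p q \<in> P" using assms pq by (auto simp: nl_ideal_def)
  ultimately show "sup x y \<in> ideal_adjoin P a" by (auto simp: ideal_adjoin_def)
qed

lemma subset_ideal_adjoin: "P \<subseteq> ideal_adjoin P a"
  unfolding ideal_adjoin_def by (blast intro: sup_ge1)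

lemma mem_ideal_adjoin: "nl_ideal P \<Longrightarrow> a \<in> ideal_adjoin P a"
  by (auto simp: ideal_adjoin_def nl_ideal_def)

lemma nl_ideal_proper_iff: "nl_ideal I \<Longrightarrow> I \<noteq> UNIV \<longleftrightarrow> top \<notin> I"
  unfolding nl_ideal_def by (blast intro: top_greatest)

lemma nl_ideal_Union_chain:
  assumes "C \<noteq> {}" and ideals: "\<And>I. I \<in> C \<Longrightarrow> nl_ideal I"
    and chain: "\<And>I J. I \<in> C \<Longrightarrow> J \<in> C \<Longrightarrow> I \<subseteq> J \<or> J \<subseteq> I"
  shows "nl_ideal (\<Union>C)"
  unfolding nl_ideal_def
proof (intro conjI allI impI)
  show "\<Union>C \<noteq> {}" using assms by (fastforce simp: nl_ideal_def)
next
  fix x y assume "y \<in> \<Union>C" "x \<le> y"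
  then show "x \<in> \<Union>C" using ideals by (auto simp: nl_ideal_def)
next
  fix x y assume "x \<in> \<Union>C" "y \<in> \<Union>C"
  then obtain I J where "I \<in> C" "J \<in> C" "x \<in> I" "y \<in> J" by blast
  then obtain K where "K \<in> C" "x \<in> K" "y \<in> K" using chain by blast
  moreover from this have "sup x y \<in> K" using ideals[of K] unfolding nl_ideal_def by blast
  ultimately show "sup x y \<in> \<Union>C" by blast
qed

text \<open>Zorn's lemma for an arbitrary set \<open>F\<close>: the choice \<open>{top}\<close>
  yields maximal ideals, a filter yields prime ideals.\<close>

lemma exists_maximal_disjoint_ideal:
  assumes "nl_ideal I" "I \<inter> F = {}"
  obtains M where "nl_ideal M" "I \<subseteq> M" "M \<inter> F = {}"
    "\<forall>J. nl_ideal J \<and> M \<subseteq> J \<and> J \<inter> F = {} \<longrightarrow> J = M"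
proof -
  let ?A = "{J. nl_ideal J \<and> I \<subseteq> J \<and> J \<inter> F = {}}"
  have "\<exists>M\<in>?A. \<forall>X\<in>?A. M \<subseteq> X \<longrightarrow> X = M"
  proof (rule subset_Zorn_nonempty)
    show "?A \<noteq> {}" using assms by auto
  next
    fix C assume C: "C \<noteq> {}" "subset.chain ?A C"
    then have "C \<subseteq> ?A" and "\<And>I J. I \<in> C \<Longrightarrow> J \<in> C \<Longrightarrow> I \<subseteq> J \<or> J \<subseteq> I"
      by (auto simp: subset_chain_def)
    moreover from this C(1) have "nl_ideal (\<Union>C)" by (intro nl_ideal_Union_chain) auto
    ultimately show "\<Union>C \<in> ?A" using C(1) by auto
  qed
  then obtain M where M: "M \<in> ?A" "\<forall>X\<in>?A. M \<subseteq> X \<longrightarrow> X = M" by (rule bexE)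
  show thesis
  proof (rule that[of M])
    show "\<forall>J. nl_ideal J \<and> M \<subseteq> J \<and> J \<inter> F = {} \<longrightarrow> J = M" using M by blast
  qed (use M(1) in auto)
qed

lemma exists_maximal_ideal:
  fixes I :: "'a::distributive_nearlattice set"
  assumes "nl_ideal I" "top \<notin> I"
  obtains M where "maximal_ideal M" "I \<subseteq> M"
proof (rule exists_maximal_disjoint_ideal[OF assms(1), of "{top}"])
  show "I \<inter> {top} = {}" using assms(2) by simp
next
  fix M assume M: "nl_ideal M" "I \<subseteq> M" "M \<inter> {top} = {}"
    and max: "\<forall>J. nl_ideal J \<and> M \<subseteq> J \<and> J \<inter> {top} = {} \<longrightarrow> J = M"
  have "J = M" if "nl_ideal J" "J \<noteq> UNIV" "M \<subseteq> J" for J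
    using max that nl_ideal_proper_iff[OF that(1)] by simp
  with M have "maximal_ideal M"
    unfolding maximal_ideal_def using nl_ideal_proper_iff by auto
  then show thesis using that M(2) by blast
qed

text \<open>An ideal maximal among those missing \<open>F\<close> is prime: adjoining any outside
  element makes it meet \<open>F\<close>.\<close>

lemma prime_ideal_separation:
  fixes F :: "'a::distributive_nearlattice set"
  assumes F: "nl_filter F" and "nl_ideal I" "I \<inter> F = {}"
  obtains P where "prime_ideal P" "I \<subseteq> P" "P \<inter> F = {}"
proof -
  obtain P where P: "nl_ideal P" "I \<subseteq> P" "P \<inter> F = {}"
    and max: "\<forall>J. nl_ideal J \<and> P \<subseteq> J \<and> J \<inter> F = {} \<longrightarrow> J = P"
    by (rule exists_maximal_disjoint_ideal[OF assms(2,3)])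
  have top: "top \<in> F" and up: "\<And>x y. x \<in> F \<Longrightarrow> x \<le> y \<Longrightarrow> y \<in> F"
    and meet: "\<And>x y m. x \<in> F \<Longrightarrow> y \<in> F \<Longrightarrow> is_inf_on UNIV x y m \<Longrightarrow> m \<in> F"
    using F unfolding nl_filter_def by blast+
  have join: "\<And>p q. p \<in> P \<Longrightarrow> q \<in> P \<Longrightarrow> sup p q \<in> P"
    using P(1) by (auto simp: nl_ideal_def)
  have hits: "\<exists>p\<in>P. sup p a \<in> F" if "a \<notin> P" for a
  proof -
    have "ideal_adjoin P a \<noteq> P" using mem_ideal_adjoin[OF P(1)] that by blast
    then have "ideal_adjoin P a \<inter> F \<noteq> {}"
      using max nl_ideal_adjoin[OF P(1)] subset_ideal_adjoin by blast
    then show ?thesis using up by (auto simp: ideal_adjoin_def)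
  qed
  have "a \<in> P \<or> b \<in> P" if inf: "is_inf_on UNIV a b m" and m: "m \<in> P" for a b m
  proof (rule ccontr)
    assume "\<not> (a \<in> P \<or> b \<in> P)"
    then obtain p q where pq: "p \<in> P" "q \<in> P" "sup p a \<in> F" "sup q b \<in> F"
      using hits by blast
    \<comment> \<open>Joining \<open>p\<close> and \<open>q\<close> keeps both
      \<open>sup r a\<close> and \<open>sup r b\<close> in \<open>F\<close>; joining
      \<open>m\<close> as well makes \<open>r\<close> their infimum, so \<open>r\<close> lies in
      both \<open>P\<close> and \<open>F\<close>.\<close>
    define r where "r = sup (sup p q) m"
    have "r \<in> P" using join pq m by (simp add: r_def)
    have "sup r a \<in> F" using pq(3) by (rule up) (simp add: r_def le_supI1)
    moreover have "sup r b \<in> F" using pq(4) by (rule up) (simp add: r_def le_supI1)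
    moreover have "is_inf_on UNIV (sup r a) (sup r b) r"
      using is_inf_on_sup_left[OF inf] by (simp add: r_def)
    ultimately have "r \<in> F" using meet by blast
    with \<open>r \<in> P\<close> P(3) show False by blast
  qed
  moreover have "P \<noteq> UNIV" using P(3) top by blast
  ultimately have "prime_ideal P" using P(1) unfolding prime_ideal_def by blast
  with P show thesis using that by blast
qed

section \<open>From kernels to \<alpha>-filters\<close>

lemma nl_ideal_atMost: "nl_ideal {..z}"
  by (auto simp: nl_ideal_def)

lemma congruence_kernel_ideal_congruence:
  "congruence_kernel (ideal_congruence I) = {a. \<exists>i\<in>I. sup a i = top}"
  by (auto simp: congruence_kernel_def ideal_congruence_def)

lemma alpha_filter_ideal_congruence_kernel:
  fixes I :: "'a::distributive_nearlattice set"
  assumes I: "nl_ideal I"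
  shows "alpha_filter (congruence_kernel (ideal_congruence I))"
  unfolding alpha_filter_def nl_filter_def congruence_kernel_ideal_congruence
proof (intro conjI allI impI ballI)
  show "top \<in> {a. \<exists>i\<in>I. sup a i = top}" using I by (auto simp: nl_ideal_def)
next
  fix x y :: 'a assume "x \<in> {a. \<exists>i\<in>I. sup a i = top}" "x \<le> y"
  then show "y \<in> {a. \<exists>i\<in>I. sup a i = top}"
    by (auto, metis order_refl sup_mono top_unique)
next
  fix x y m :: 'a
  assume "x \<in> {a. \<exists>i\<in>I. sup a i = top}" "y \<in> {a. \<exists>i\<in>I. sup a i = top}"
    and inf: "is_inf_on UNIV x y m"
  then obtain i j where ij: "i \<in> I" "j \<in> I" "sup x i = top" "sup y j = top" by auto
  define k where "k = sup i j"
  have k: "k \<in> I" using I ij by (auto simp: k_def nl_ideal_def)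
  \<comment> \<open>Both arguments of this infimum equal \<open>top\<close>, which forces
    \<open>sup m k = top\<close>.\<close>
  have "is_inf_on UNIV (sup (sup m k) x) (sup (sup m k) y) (sup m k)"
    by (rule is_inf_on_sup_left[OF inf]) simp
  moreover have "sup (sup m k) x = top"
    using ij(3) by (metis k_def sup_assoc sup_commute sup_top_nearlattice(1))
  moreover have "sup (sup m k) y = top"
    using ij(4) by (metis k_def sup_assoc sup_commute sup_top_nearlattice(1))
  ultimately have "sup m k = top" by (auto simp: is_inf_on_def intro: top_le)
  then show "m \<in> {a. \<exists>i\<in>I. sup a i = top}" using k by blast
next
  fix a :: 'a assume "a \<in> {a. \<exists>i\<in>I. sup a i = top}"
  \<comment> \<open>The same witness \<open>i\<close> works throughout, because it lies in
    \<open>annihilator a\<close>.\<close>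
  then show "biannihilator a \<subseteq> {a. \<exists>i\<in>I. sup a i = top}"
    by (auto simp: biannihilator_def annihilator_def sup_commute)
qed

section \<open>From \<alpha>-filters to kernels\<close>

lemma annihilator_mono:
  assumes "x \<le> y"
  shows "annihilator x \<subseteq> annihilator y"
proof
  fix z assume "z \<in> annihilator x"
  then have "top \<le> sup z y" using sup_mono[OF order_refl assms, of z] by (simp add: annihilator_def)
  then show "z \<in> annihilator y" by (simp add: annihilator_def top_unique)
qed

lemma mem_biannihilator_iff: "x \<in> biannihilator c \<longleftrightarrow> annihilator c \<subseteq> annihilator x"
  by (auto simp: biannihilator_def annihilator_def sup_commute)

lemma annihilator_sup_subset_filter:
  fixes F :: "'a::distributive_nearlattice set"
  assumes normal: "normal_nearlattice TYPE('a)" and F: "nl_filter F"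
    and xy: "annihilator x \<subseteq> F" "annihilator y \<subseteq> F"
  shows "annihilator (sup x y) \<subseteq> F"
proof (rule subsetI, rule ccontr)
  fix z assume z: "z \<in> annihilator (sup x y)" and "z \<notin> F"
  then have "{..z} \<inter> F = {}" using F unfolding nl_filter_def by blast
  then obtain P where P: "prime_ideal P" "{..z} \<subseteq> P" "P \<inter> F = {}"
    using prime_ideal_separation[OF F nl_ideal_atMost] by blast
  have ideal: "nl_ideal P" using P(1) by (simp add: prime_ideal_def)
  have above: "\<exists>M. maximal_ideal M \<and> P \<subseteq> M \<and> a \<in> M" if "annihilator a \<subseteq> F" for a
  proof -
    \<comment> \<open>Otherwise some \<open>p\<close> in \<open>P\<close> has
      \<open>sup p a = top\<close>, so \<open>p\<close> lies in \<open>annihilator a\<close> and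
      hence in \<open>F\<close>.\<close>
    have "top \<notin> ideal_adjoin P a"
      using that P(3) by (auto simp: ideal_adjoin_def annihilator_def top_unique)
    then obtain M where "maximal_ideal M" "ideal_adjoin P a \<subseteq> M"
      using exists_maximal_ideal[OF nl_ideal_adjoin[OF ideal]] by blast
    then show ?thesis using subset_ideal_adjoin[of P a] mem_ideal_adjoin[OF ideal, of a] by blast
  qed
  obtain M where M: "maximal_ideal M" "P \<subseteq> M" "x \<in> M" "y \<in> M"
    using above[OF xy(1)] above[OF xy(2)] normal P(1) unfolding normal_nearlattice_def by metis
  then have "nl_ideal M" "top \<notin> M"
    using nl_ideal_proper_iff by (auto simp: maximal_ideal_def)
  moreover from this M P(2) have "sup z (sup x y) \<in> M"
    by (auto simp: nl_ideal_def)
  ultimately show False using z by (simp add: annihilator_def)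
qed

lemma alpha_filter_imp_alpha_ideal_congruence_kernel:
  fixes F :: "'a::distributive_nearlattice set"
  assumes normal: "normal_nearlattice TYPE('a)"
    and quasi: "quasicomplemented_nearlattice TYPE('a)"
    and F: "alpha_filter F"
  shows "alpha_ideal_congruence_kernel F"
proof -
  have filter: "nl_filter F" and bi: "\<And>a. a \<in> F \<Longrightarrow> biannihilator a \<subseteq> F"
    using F by (auto simp: alpha_filter_def)
  define I where "I = {x. annihilator x \<subseteq> F}"
  have quasi_I: "\<exists>b\<in>I. sup a b = top" if "a \<in> F" for a
  proof -
    obtain b where b: "biannihilator a = annihilator b"
      using quasi by (auto simp: quasicomplemented_nearlattice_def)
    have "a \<in> annihilator b" unfolding b[symmetric] mem_biannihilator_iff by simp
    \<comment> \<open>Here \<open>annihilator b\<close> is \<open>biannihilator a\<close>, which the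
      \<alpha>-filter \<open>F\<close> contains.\<close>
    moreover have "b \<in> I" using bi[OF that] b by (simp add: I_def)
    ultimately show ?thesis by (auto simp: annihilator_def)
  qed
  have "I \<noteq> {}" using quasi_I[of top] filter by (auto simp: nl_filter_def)
  then have "nl_ideal I"
    using annihilator_sup_subset_filter[OF normal filter] annihilator_mono
    unfolding nl_ideal_def I_def by blast
  \<comment> \<open>A common element \<open>x\<close> gives
    \<open>annihilator c \<subseteq> annihilator x \<subseteq> F\<close>.\<close>
  moreover have "c \<in> I" if "I \<inter> biannihilator c \<noteq> {}" for c
    using that unfolding I_def by (auto simp: mem_biannihilator_iff subset_iff)
  ultimately have "alpha_ideal I" by (simp add: alpha_ideal_def)
  moreover have "F = congruence_kernel (ideal_congruence I)"
    unfolding congruence_kernel_ideal_congruence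
    using quasi_I by (auto simp: I_def annihilator_def)
  ultimately show ?thesis by (auto simp: alpha_ideal_congruence_kernel_def)
qed

theorem theorem3p15:
  fixes F :: "'a::distributive_nearlattice set"
  assumes "normal_nearlattice TYPE('a)"
    and "quasicomplemented_nearlattice TYPE('a)"
  shows "alpha_filter F \<longleftrightarrow> alpha_ideal_congruence_kernel F"
proof
  show "alpha_ideal_congruence_kernel F" if "alpha_filter F"
    using assms that by (rule alpha_filter_imp_alpha_ideal_congruence_kernel)
  show "alpha_filter F" if "alpha_ideal_congruence_kernel F"
    using that alpha_filter_ideal_congruence_kernel
    unfolding alpha_ideal_congruence_kernel_def alpha_ideal_def by blast
qed

end
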